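(* Let $U$ and $Z$ be (real) Hilbert spaces, let $a:U\times U\to\mathbb{R}$, $b:Z\times U\to\mathbb{R}$, $d:U\times U\to\mathbb{R}$, $e:Z\times Z\to\mathbb{R}$ be bounded bilinear forms such that $a$ and $e$ are coercive and $d$ is positive semi-definite, and let $f^\star:U\to\mathbb{R}$ and $g^\star:U\times Z\to\mathbb{R}$ be bounded linear forms. Let $({\bf u},{\bf z},{\bf p})\in U\times Z\times U$ be the unique solution of $$\begin{array}{lcll} d({\bf u},{\bf v})+e({\bf z},{\bf y})+a({\bf v},{\bf p})+b({\bf y},{\bf p})&=&g^\star\big(({\bf v},{\bf y})\big)&\text{for all }({\bf v},{\bf y})\in U\times Z,\\ a({\bf u},{\bf q})+b({\bf z},{\bf q})&=&f^\star({\bf q})&\text{for all }{\bf q}\in U.\end{array}$$ Then for arbitrary closed subspaces $U^\delta\subset U$ and $Z^\delta\subset Z$ there exists a unique Galerkin solution $({\bf u}^\delta,{\bf z}^\delta,{\bf p}^\delta)\in U^\delta\times Z^\delta\times U^\delta$ of this problem, and it is quasi-optimal, i.e., $$\|{\bf u}-{\bf u}^\delta\|_U+\|{\bf z}-{\bf z}^\delta\|_Z+\|{\bf p}-{\bf p}^\delta\|_U\le C_{\rm opt}\inf_{({\bf v},{\bf y},{\bf q})\in U^\delta\times Z^\delta\times U^\delta}\big(\|{\bf u}-{\bf v}\|_U+\|{\bf z}-{\bf y}\|_Z+\|{\bf p}-{\bf q}\|_U\big),$$ where $C_{\rm opt}>0$ is proportional (with an absolute factor) to the product of $C_{\rm stab}$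 and $C_{\rm cont}$. Here $C_{\rm cont}$ is the maximum of the continuity constants of $a,b,d,e$, and $C_{\rm stab}$ is the uniform stability constant described in the context; in particular $C_{\rm opt}$ does not depend on the choice of the subspaces $U^\delta$, $Z^\delta$.
   Context: A bilinear form $a$ on $U\times U$ is coercive with constant $\alpha>0$ if $a({\bf v},{\bf v})\ge\alpha\|{\bf v}\|_U^2$ for all ${\bf v}\in U$ (analogously for $e$ on $Z\times Z$); $d$ is positive semi-definite if $d({\bf v},{\bf v})\ge0$ for all ${\bf v}\in U$. The continuity constant of a bounded bilinear form is its norm. The Galerkin solution $({\bf u}^\delta,{\bf z}^\delta,{\bf p}^\delta)\in U^\delta\times Z^\delta\times U^\delta$ is the solution of the same two equations with $({\bf u},{\bf z},{\bf p})$ replaced by $({\bf u}^\delta,{\bf z}^\delta,{\bf p}^\delta)$ and with test functions $({\bf v},{\bf y})$ restricted to $U^\delta\times Z^\delta$ and ${\bf q}$ restricted to $U^\delta$. The constant $C_{\rm stab}>0$ depends only on the continuity constants of $a,b,d,e$ and the coercivity constants of $a,e$, and is such that, for all bounded linear forms $f^\star,g^\star$, the solution of the saddle-point problem satisfies $\|{\bf u}\|_U+\|{\bf z}\|_Z+\|{\bf p}\|_U\le C_{\rm stab}(\|f^\star\|_{U'}+\|g^\star\|_{U'\times Z'})$, and such that the same bound, with the same constant, holds for the problem posed on any closed subspaces $U^\delta\subset U$, $Z^\delta\subset Z$ (with dual norms taken with respect to these subspaces). *)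

theory Defs
  imports "HOL-Analysis.Analysis"
begin

definition coercive :: "('a::real_inner \<Rightarrow> 'a \<Rightarrow> real) \<Rightarrow> real \<Rightarrow> bool" where
  "coercive B \<alpha> \<longleftrightarrow> 0 < \<alpha> \<and> (\<forall>v. B v v \<ge> \<alpha> * (norm v)\<^sup>2)"

definition pos_semidef :: "('a::real_inner \<Rightarrow> 'a \<Rightarrow> real) \<Rightarrow> bool" where
  "pos_semidef B \<longleftrightarrow> (\<forall>v. B v v \<ge> 0)"

(* As in the library's onorm, 0 / 0 = 0 makes the arguments of norm zero harmless. *)
definition bilinear_norm :: "('a::real_inner \<Rightarrow> 'b::real_inner \<Rightarrow> real) \<Rightarrow> real" where
  "bilinear_norm B = (SUP (x, y) \<in> UNIV. \<bar>B x y\<bar> / (norm x * norm y))"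

definition cont_const ::
  "('u::real_inner \<Rightarrow> 'u \<Rightarrow> real) \<Rightarrow> ('z::real_inner \<Rightarrow> 'u \<Rightarrow> real) \<Rightarrow>
   ('u \<Rightarrow> 'u \<Rightarrow> real) \<Rightarrow> ('z \<Rightarrow> 'z \<Rightarrow> real) \<Rightarrow> real" where
  "cont_const a b d e =
     Max {bilinear_norm a, bilinear_norm b, bilinear_norm d, bilinear_norm e}"

(* Norm of the restriction of f to the subspace S, as an element of the dual of S;
   for S = UNIV this is onorm f. *)
definition dual_norm_on :: "'a::real_inner set \<Rightarrow> ('a \<Rightarrow> real) \<Rightarrow> real" where
  "dual_norm_on S f = (SUP x \<in> S. \<bar>f x\<bar> / norm x)"

(* The saddle-point problem posed on U and Z: U = Z = UNIV gives the continuous problem,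
   closed subspaces give the Galerkin problem. *)
definition saddle_point_solution ::
  "('u::real_inner \<Rightarrow> 'u \<Rightarrow> real) \<Rightarrow> ('z::real_inner \<Rightarrow> 'u \<Rightarrow> real) \<Rightarrow>
   ('u \<Rightarrow> 'u \<Rightarrow> real) \<Rightarrow> ('z \<Rightarrow> 'z \<Rightarrow> real) \<Rightarrow> 'u set \<Rightarrow> 'z set \<Rightarrow>
   ('u \<Rightarrow> real) \<Rightarrow> ('u \<times> 'z \<Rightarrow> real) \<Rightarrow> 'u \<times> 'z \<times> 'u \<Rightarrow> bool" where
  "saddle_point_solution a b d e U Z f g = (\<lambda>(u, z, p).
     u \<in> U \<and> z \<in> Z \<and> p \<in> U \<and>
     (\<forall>v\<in>U. \<forall>y\<in>Z. d u v + e z y + a v p + b y p = g (v, y)) \<and>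
     (\<forall>q\<in>U. a u q + b z q = f q))"

(* C is a stability constant for the problem on the whole spaces (U = Z = UNIV) and on all
   closed subspaces. The linear forms are taken on the whole spaces: by Hahn-Banach every
   bounded linear form on a subspace is the restriction of such a form, and only the dual
   norm with respect to the subspace enters the bound. *)
definition uniform_stability_const ::
  "('u::real_inner \<Rightarrow> 'u \<Rightarrow> real) \<Rightarrow> ('z::real_inner \<Rightarrow> 'u \<Rightarrow> real) \<Rightarrow>
   ('u \<Rightarrow> 'u \<Rightarrow> real) \<Rightarrow> ('z \<Rightarrow> 'z \<Rightarrow> real) \<Rightarrow> real \<Rightarrow> bool" where
  "uniform_stability_const a b d e C \<longleftrightarrow> 0 < C \<and>
     (\<forall>U Z f g u z p. subspace U \<and> closed U \<and> subspace Z \<and> closed Z \<and>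
        bounded_linear f \<and> bounded_linear g \<and>
        saddle_point_solution a b d e U Z f g (u, z, p) \<longrightarrow>
        norm u + norm z + norm p \<le> C * (dual_norm_on U f + dual_norm_on (U \<times> Z) g))"

(* A stability constant as a function of the continuity constants nb, nd of b, d and the
   coercivity constants \<alpha>, \<gamma> of a, e. It is explicit because an existentially quantified
   function inside a theorem could depend on the Hilbert spaces, which are types.
   With \<rho> = 1 + nd / \<alpha>, M = 1 + (nb / \<alpha>) * \<rho> and N the sum of the norms of the data, one has
   norm z \<le> M * N / \<gamma>, and the two coercivity estimates in a for u and p give the rest. *)
definition stab_const :: "real \<Rightarrow> real \<Rightarrow> real \<Rightarrow> real \<Rightarrow> real" where
  "stab_const nb nd \<alpha> \<gamma> =
     (let \<rho> = 1 + nd / \<alpha> in \<rho> / \<alpha> + (1 + nb / \<alpha> * \<rho>)\<^sup>2 / \<gamma>)"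

(* The absolute factor is explicit for the same reason. Galerkin orthogonality and stability
   give 1 + 2 * Cstab * Ccont, and 1 \<le> 2 * Cstab * Ccont unless both spaces are trivial. *)
definition opt_const :: "real \<Rightarrow> real \<Rightarrow> real" where
  "opt_const Cstab Ccont = 4 * Cstab * Ccont"

end

theory Submission
  imports Defs
begin

text \<open>
  Let \<open>T z\<close> be the solution in \<open>U\<close> of \<open>a(T z, q) = b(z, q)\<close>. Testing the first equation with
  \<open>(-T y, y)\<close> removes \<open>p\<close>, and substituting \<open>u = u\<^sub>f - T z\<close>, where \<open>a(u\<^sub>f, q) = f(q)\<close>, removes \<open>u\<close>.
  What is left is a problem for \<open>z\<close> with the form \<open>e(z, y) + d(T z, T y)\<close>, which is coercive
  because \<open>d\<close> is positive semi-definite, so the Lax--Milgram lemma applies, on subspaces as well.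
  For quasi-optimality, the difference of the Galerkin solution and a discrete triple solves the
  discrete problem with data that are the residuals of the error of that triple.
\<close>

section \<open>The Lax--Milgram lemma on closed subspaces\<close>

text \<open>The representative minimises \<open>J\<close> over \<open>S\<close>: a minimising
  sequence is Cauchy by the parallelogram identity, and at its limit \<open>J\<close> cannot
  decrease along any direction of \<open>S\<close>.\<close>

lemma riesz_representation_on:
  fixes L :: "'a::{real_inner, complete_space} \<Rightarrow> real"
  assumes S: "subspace S" "closed S" and L: "bounded_linear L"
  shows "\<exists>x\<in>S. \<forall>y\<in>S. x \<bullet> y = L y"
proof -
  interpret L: bounded_linear L by fact
  define J where "J v = (norm v)\<^sup>2 - 2 * L v" for v
  obtain K where K: "\<And>v. \<bar>L v\<bar> \<le> norm v * K"
    using L.bounded by auto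
  have lower: "- K\<^sup>2 \<le> J v" for v
  proof -
    have "0 \<le> (norm v - K)\<^sup>2" by simp
    then show ?thesis
      using K[of v] by (simp add: J_def power2_eq_square algebra_simps)
  qed
  have bdd: "bdd_below (J ` S)"
    by (rule bdd_belowI2[OF lower])
  have ne: "S \<noteq> {}"
    using S subspace_0 by blast
  define m where "m = (INF v\<in>S. J v)"
  have m_le: "m \<le> J v" if "v \<in> S" for v
    unfolding m_def by (rule cINF_lower[OF bdd that])
  have "\<exists>x\<in>S. J x < m + inverse (real (Suc n))" for n
    using cINF_less_iff[OF ne bdd, of "m + inverse (real (Suc n))"] by (auto simp: m_def)
  then obtain X where X: "\<And>n. X n \<in> S" "\<And>n. J (X n) < m + inverse (real (Suc n))"
    by metis
  have parallelogram: "(norm (x - y))\<^sup>2 \<le> 2 * (J x + J y - 2 * m)" if "x \<in> S" "y \<in> S" for x y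
  proof -
    \<comment> \<open>The midpoint lies in \<open>S\<close>, so \<open>J\<close> is at least
      \<open>m\<close> there.\<close>
    have mid: "(1/2) *\<^sub>R (x + y) \<in> S"
      using that S by (intro subspace_scale subspace_add)
    have "(norm (x - y))\<^sup>2 = 2 * (J x + J y - 2 * J ((1/2) *\<^sub>R (x + y)))"
      by (simp add: J_def power2_norm_eq_inner L.scaleR L.add algebra_simps inner_commute)
    then show ?thesis
      using m_le[OF mid] by simp
  qed
  have "Cauchy X"
  proof (rule metric_CauchyI)
    fix r :: real assume "0 < r"
    then obtain N where "inverse (real (Suc N)) < r\<^sup>2 / 4"
      using reals_Archimedean[of "r\<^sup>2 / 4"] by auto
    then have N: "4 * inverse (real (Suc N)) < r\<^sup>2"
      by (simp only: less_divide_eq_numeral1 mult.commute)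
    have small: "4 * (J (X n) - m) < r\<^sup>2" if "N \<le> n" for n
    proof -
      have *: "inverse (real (Suc n)) \<le> inverse (real (Suc N))"
        using that by (intro le_imp_inverse_le) auto
      have "4 * (J (X n) - m) < 4 * inverse (real (Suc n))"
        using X(2)[of n] by (simp only: mult_less_cancel_left_pos diff_less_eq add.commute zero_less_numeral)
      also have "\<dots> \<le> 4 * inverse (real (Suc N))"
        using * by (simp only: mult_le_cancel_left_pos zero_less_numeral)
      finally show ?thesis using N by (rule less_trans)
    qed
    have "dist (X i) (X j) < r" if "N \<le> i" "N \<le> j" for i j
    proof -
      have "(norm (X i - X j))\<^sup>2 < r\<^sup>2"
        using parallelogram[OF X(1) X(1), of i j] small[OF that(1)] small[OF that(2)]
        by (simp only: right_diff_distrib distrib_left)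
      then show ?thesis
        using \<open>0 < r\<close> by (simp add: dist_norm power2_less_imp_less)
    qed
    then show "\<exists>N. \<forall>i\<ge>N. \<forall>j\<ge>N. dist (X i) (X j) < r" by blast
  qed
  then obtain x where x: "X \<longlonglongrightarrow> x"
    using Cauchy_convergent convergent_def by blast
  have xS: "x \<in> S"
    using closed_sequentially[OF S(2)] X(1) x by blast
  have lim: "(\<lambda>n. J (X n)) \<longlonglongrightarrow> J x"
    unfolding J_def by (intro tendsto_intros L.tendsto x)
  have "(\<lambda>n. m + inverse (real (Suc n))) \<longlonglongrightarrow> m"
    using tendsto_add[OF tendsto_const LIMSEQ_inverse_real_of_nat, of m] by simp
  then have Jx: "J x \<le> m"
    using LIMSEQ_le[OF lim] less_imp_le[OF X(2)] by blast
  have "x \<bullet> y = L y" if y: "y \<in> S" for y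
  proof (cases "y = 0")
    case False
    define c where "c = x \<bullet> y - L y"
    \<comment> \<open>The factor \<open>- c / (y \<bullet> y)\<close> minimises \<open>J\<close> on
      the line through \<open>x\<close> in direction \<open>y\<close>. The drop is
      \<open>c\<^sup>2 / (y \<bullet> y)\<close>, so minimality of \<open>x\<close> forces
      \<open>c = 0\<close>.\<close>
    have "m \<le> J (x + (- c / (y \<bullet> y)) *\<^sub>R y)"
      using xS y S by (intro m_le subspace_add subspace_scale)
    also have "\<dots> = J x - c\<^sup>2 / (y \<bullet> y)"
      using False unfolding J_def power2_norm_eq_inner c_def
      by (simp add: L.scaleR L.add L.diff inner_commute inner_add inner_diff field_simps power2_eq_square)
    finally have "c\<^sup>2 / (y \<bullet> y) \<le> 0" using Jx by linarith
    then have "c = 0" using False by (simp add: divide_le_0_iff dot_square_norm)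
    then show ?thesis by (simp add: c_def)
  qed simp
  then show ?thesis using xS by blast
qed

text \<open>\<open>R x\<close> represents the residual of \<open>x\<close> on \<open>S\<close>, so
  solutions are the fixed points of \<open>x - r *\<^sub>R R x\<close>; coercivity makes this map a
  contraction of \<open>S\<close> for a suitable step size \<open>r\<close>.\<close>

lemma lax_milgram_on:
  fixes B :: "'a::{real_inner, complete_space} \<Rightarrow> 'a \<Rightarrow> real"
  assumes S: "subspace S" "closed S" and B: "bounded_bilinear B" "coercive B \<alpha>"
    and L: "bounded_linear L"
  shows "\<exists>x\<in>S. \<forall>y\<in>S. B x y = L y"
proof -
  interpret B: bounded_bilinear B by fact
  interpret L: bounded_linear L by fact
  have \<alpha>: "0 < \<alpha>" and coer: "\<And>v. \<alpha> * (norm v)\<^sup>2 \<le> B v v"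
    using B(2) by (auto simp: coercive_def)
  obtain K0 where K0: "\<And>x y. \<bar>B x y\<bar> \<le> norm x * norm y * K0"
    using B.bounded by auto
  \<comment> \<open>\<open>\<alpha> < K\<close> keeps the root in \<open>c\<close> real, and makes
    \<open>K\<close> positive even where \<open>K0\<close> is not, as can happen on a trivial
    space.\<close>
  define K where "K = max K0 (\<alpha> + 1)"
  have K: "\<bar>B x y\<bar> \<le> norm x * norm y * K" for x y
    by (rule order_trans[OF K0]) (simp add: K_def mult_left_mono)
  have K\<alpha>: "\<alpha> < K" by (simp add: K_def)
  have "\<forall>x. \<exists>r\<in>S. \<forall>y\<in>S. r \<bullet> y = B x y - L y"
    using riesz_representation_on[OF S] bounded_linear_sub[OF B.bounded_linear_right L] by blast
  then obtain R where RS: "\<And>x. R x \<in> S" and R: "\<And>x y. y \<in> S \<Longrightarrow> R x \<bullet> y = B x y - L y"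
    by metis
  \<comment> \<open>The step size minimises the contraction bound \<open>1 - 2 r \<alpha> + r\<^sup>2 K\<^sup>2\<close>.\<close>
  define r where "r = \<alpha> / K\<^sup>2"
  define c where "c = sqrt (1 - \<alpha>\<^sup>2 / K\<^sup>2)"
  have r: "0 < r" using \<alpha> K\<alpha> by (auto simp: r_def)
  have "\<alpha>\<^sup>2 \<le> K\<^sup>2" using \<alpha> K\<alpha> by (intro power_mono) auto
  then have c2: "c\<^sup>2 = 1 - \<alpha>\<^sup>2 / K\<^sup>2"
    using \<alpha> K\<alpha> unfolding c_def by (subst real_sqrt_pow2) (auto simp: divide_le_eq_1)
  have c: "0 \<le> c" "c < 1"
    using \<open>\<alpha>\<^sup>2 \<le> K\<^sup>2\<close> \<alpha> K\<alpha> by (auto simp: c_def divide_le_eq_1)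
  have contr: "dist (x - r *\<^sub>R R x) (y - r *\<^sub>R R y) \<le> c * dist x y" if "x \<in> S" "y \<in> S" for x y
  proof -
    define w where "w = x - y"
    define s where "s = R x - R y"
    have wS: "w \<in> S" and sS: "s \<in> S"
      using that S RS by (auto simp: w_def s_def intro: subspace_diff)
    have s: "s \<bullet> v = B w v" if "v \<in> S" for v
      using that by (simp add: s_def w_def inner_diff_left R B.diff_left)
    \<comment> \<open>\<open>s\<close> lies in \<open>S\<close> and represents \<open>B w\<close>
      there, so it may serve as its own test vector.\<close>
    have "norm s * norm s \<le> norm w * K * norm s"
      using s[OF sS] K[of w s] by (simp add: power2_norm_eq_inner[symmetric] power2_eq_square mult_ac)
    then have "norm s \<le> norm w * K"
      using K\<alpha> \<alpha> by (cases "s = 0") auto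
    then have s2: "(norm s)\<^sup>2 \<le> (norm w)\<^sup>2 * K\<^sup>2"
      by (metis norm_ge_zero power_mono power_mult_distrib)
    have "(norm (w - r *\<^sub>R s))\<^sup>2 = (norm w)\<^sup>2 - 2 * r * B w w + r\<^sup>2 * (norm s)\<^sup>2"
      using s[OF wS] unfolding power2_norm_eq_inner
      by (simp add: inner_diff inner_commute power2_eq_square algebra_simps)
    also have "\<dots> \<le> (norm w)\<^sup>2 - 2 * r * (\<alpha> * (norm w)\<^sup>2) + r\<^sup>2 * ((norm w)\<^sup>2 * K\<^sup>2)"
      using r coer[of w] s2 by (intro add_mono diff_mono mult_left_mono) auto
    also have "\<dots> = (c * norm w)\<^sup>2"
      using \<alpha> K\<alpha> unfolding power_mult_distrib c2 r_def
      by (simp add: field_simps power2_eq_square)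
    finally have "norm (w - r *\<^sub>R s) \<le> c * norm w"
      by (rule power2_le_imp_le) (use c in simp)
    moreover have "(x - r *\<^sub>R R x) - (y - r *\<^sub>R R y) = w - r *\<^sub>R s"
      by (simp add: w_def s_def scaleR_diff_right)
    ultimately show ?thesis
      unfolding dist_norm w_def[symmetric] by metis
  qed
  have "\<exists>!x\<in>S. x - r *\<^sub>R R x = x"
  proof (rule Banach_fix)
    show "complete S" using S by (simp add: complete_eq_closed)
    show "S \<noteq> {}" using S subspace_0 by blast
    show "(\<lambda>x. x - r *\<^sub>R R x) ` S \<subseteq> S"
      using S RS by (auto intro: subspace_diff subspace_scale)
  qed (use c contr in auto)
  then obtain x where "x \<in> S" "r *\<^sub>R R x = 0" by auto
  then have "R x = 0" using r by simp
  then show ?thesis using R[of _ x] \<open>x \<in> S\<close> by (intro bexI[of _ x]) auto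
qed

text \<open>The difference is itself an admissible test vector. This uniqueness yields the linearity
  of solution operators.\<close>

lemma coercive_eqI_on:
  assumes S: "subspace S" and B: "bounded_bilinear B" "coercive B \<alpha>"
    and xy: "x \<in> S" "y \<in> S" and eq: "\<And>v. v \<in> S \<Longrightarrow> B x v = B y v"
  shows "x = y"
proof -
  interpret B: bounded_bilinear B by fact
  have "B (x - y) (x - y) = 0"
    using eq[of "x - y"] S xy by (simp add: B.diff_left subspace_diff)
  then have "\<alpha> * (norm (x - y))\<^sup>2 \<le> 0" and "0 < \<alpha>"
    using B(2) by (auto simp: coercive_def dest: spec[of _ "x - y"])
  then show ?thesis by (simp add: mult_le_0_iff)
qed

text \<open>Source of the a priori bounds below: test with the solution, then cancel one factor
  \<open>norm x\<close>. The hypothesis \<open>0 \<le> K\<close> covers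
  \<open>x = 0\<close>.\<close>

lemma coercive_bound:
  assumes "coercive B \<alpha>" "0 \<le> K" "B x x \<le> K * norm x"
  shows "norm x \<le> K / \<alpha>"
proof (cases "x = 0")
  case True
  then show ?thesis using assms by (simp add: coercive_def)
next
  case False
  have \<alpha>: "0 < \<alpha>" and "\<alpha> * (norm x)\<^sup>2 \<le> K * norm x"
    using assms order_trans by (auto simp: coercive_def)
  then show ?thesis using False by (simp add: field_simps power2_eq_square)
qed

text \<open>\<open>T\<close> is the operator that eliminates unknowns in the existence proof. Its
  linearity follows from uniqueness, its boundedness from the test vector
  \<open>T z\<close>.\<close>

lemma lax_milgram_operator_on:
  fixes B :: "'a::{real_inner, complete_space} \<Rightarrow> 'a \<Rightarrow> real"
    and b :: "'z::real_inner \<Rightarrow> 'a \<Rightarrow> real"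
  assumes S: "subspace S" "closed S" and B: "bounded_bilinear B" "coercive B \<alpha>"
    and b: "bounded_bilinear b"
  shows "\<exists>T. bounded_linear T \<and> (\<forall>z. T z \<in> S) \<and> (\<forall>z. \<forall>q\<in>S. B (T z) q = b z q)"
proof -
  interpret B: bounded_bilinear B by fact
  interpret b: bounded_bilinear b by fact
  have "\<forall>z. \<exists>x\<in>S. \<forall>q\<in>S. B x q = b z q"
    using lax_milgram_on[OF S B] b.bounded_linear_right by blast
  then obtain T where TS: "\<And>z. T z \<in> S" and T: "\<And>z q. q \<in> S \<Longrightarrow> B (T z) q = b z q"
    by metis
  obtain K where K: "0 < K" "\<And>x y. \<bar>b x y\<bar> \<le> norm x * norm y * K"
    using b.pos_bounded by auto
  have "bounded_linear T"
  proof (rule bounded_linear_intro)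
    show "T (x + y) = T x + T y" for x y
      using TS S T by (intro coercive_eqI_on[OF S(1) B])
        (auto simp: B.add_left b.add_left intro: subspace_add)
    show "T (t *\<^sub>R x) = t *\<^sub>R T x" for t x
      using TS S T by (intro coercive_eqI_on[OF S(1) B])
        (auto simp: B.scaleR_left b.scaleR_left intro: subspace_scale)
    show "norm (T z) \<le> norm z * (K / \<alpha>)" for z
    proof -
      have "B (T z) (T z) \<le> norm z * K * norm (T z)"
        using T[OF TS, of z] K(2)[of z "T z"] by (simp add: mult_ac)
      then show ?thesis using coercive_bound[OF B(2)] K(1) by fastforce
    qed
  qed
  then show ?thesis using TS T by blast
qed

section \<open>Norms of linear and bilinear forms\<close>

lemma norm_Pair_le_add: "norm (x, y) \<le> norm x + norm y"
  by (simp add: norm_Pair sqrt_sum_squares_le_sum)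

lemma norm_Pair_weighted_le: "norm x * s + norm y * t \<le> (s + t) * norm (x, y)"
  if "0 \<le> s" "0 \<le> t"
proof -
  have "norm x \<le> norm (x, y)" "norm y \<le> norm (x, y)"
    by (rule norm_fst_le norm_snd_le)+
  then show ?thesis
    using that by (simp add: distrib_right add_mono mult_left_mono mult.commute[of _ "norm (x, y)"]
      mult_right_mono distrib_left)
qed

text \<open>Without an upper bound the real supremum in \<open>bilinear_norm\<close> would say
  nothing. \<open>K\<close> is taken positive because it also has to bound the quotients 0 that
  arise from zero denominators.\<close>

lemma bilinear_norm_bdd_above:
  assumes "bounded_bilinear B"
  shows "bdd_above ((\<lambda>(x, y). \<bar>B x y\<bar> / (norm x * norm y)) ` UNIV)"
proof -
  obtain K where K: "0 < K" "\<And>x y. \<bar>B x y\<bar> \<le> norm x * norm y * K"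
    using bounded_bilinear.pos_bounded[OF assms] by auto
  have "\<bar>B x y\<bar> / (norm x * norm y) \<le> K" for x y
    using K(2)[of x y] K(1)
    by (cases "norm x * norm y = 0") (auto simp: divide_le_eq mult_ac)
  then show ?thesis
    by (intro bdd_aboveI2[of _ _ K]) auto
qed

text \<open>The pair \<open>(0, 0)\<close> contributes the quotient 0 to the supremum.\<close>

lemma bilinear_norm_nonneg:
  assumes "bounded_bilinear B"
  shows "0 \<le> bilinear_norm B"
  unfolding bilinear_norm_def
  by (rule cSUP_upper2[OF bilinear_norm_bdd_above[OF assms], of "(0, 0)"]) auto

lemma bilinear_norm_bound:
  assumes "bounded_bilinear B"
  shows "\<bar>B x y\<bar> \<le> bilinear_norm B * norm x * norm y"
proof (cases "x = 0 \<or> y = 0")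
  case True
  then show ?thesis
    by (auto simp: bounded_bilinear.zero_left[OF assms] bounded_bilinear.zero_right[OF assms])
next
  case False
  have "\<bar>B x y\<bar> / (norm x * norm y) \<le> bilinear_norm B"
    unfolding bilinear_norm_def
    by (rule cSUP_upper2[OF bilinear_norm_bdd_above[OF assms], of "(x, y)"]) auto
  then show ?thesis using False by (simp add: divide_le_eq mult.assoc)
qed

lemma dual_norm_on_bdd_above:
  assumes "bounded_linear f"
  shows "bdd_above ((\<lambda>x. \<bar>f x\<bar> / norm x) ` S)"
proof (rule bdd_aboveI2)
  show "\<bar>f x\<bar> / norm x \<le> onorm f" for x
    using le_onorm[OF assms, of x] by simp
qed

lemma dual_norm_on_bound:
  assumes "bounded_linear f" "x \<in> S"
  shows "\<bar>f x\<bar> \<le> dual_norm_on S f * norm x"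
proof (cases "x = 0")
  case True
  then show ?thesis by (simp add: linear_0[OF bounded_linear.linear[OF assms(1)]])
next
  case False
  have "\<bar>f x\<bar> / norm x \<le> dual_norm_on S f"
    unfolding dual_norm_on_def
    by (rule cSUP_upper[OF assms(2) dual_norm_on_bdd_above[OF assms(1)]])
  then show ?thesis using False by (simp add: divide_le_eq)
qed

lemma dual_norm_on_nonneg:
  assumes "bounded_linear f" "subspace S"
  shows "0 \<le> dual_norm_on S f"
  unfolding dual_norm_on_def
  by (rule cSUP_upper2[OF dual_norm_on_bdd_above[OF assms(1)], of 0])
    (use assms(2) subspace_0 in auto)

lemma dual_norm_on_least:
  assumes "subspace S" "0 \<le> K" "\<And>x. x \<in> S \<Longrightarrow> \<bar>f x\<bar> \<le> K * norm x"
  shows "dual_norm_on S f \<le> K"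
  unfolding dual_norm_on_def
proof (rule cSUP_least)
  show "S \<noteq> {}" using assms(1) subspace_0 by blast
  show "\<bar>f x\<bar> / norm x \<le> K" if "x \<in> S" for x
    using assms(2) assms(3)[OF that] by (cases "x = 0") (auto simp: divide_le_eq)
qed

text \<open>Applied to the reduced form that remains once \<open>u\<close> and \<open>p\<close> are
  eliminated.\<close>

lemma bounded_bilinear_add:
  assumes "bounded_bilinear B" "bounded_bilinear C"
  shows "bounded_bilinear (\<lambda>x y. B x y + C x y)"
proof -
  interpret B: bounded_bilinear B by fact
  interpret C: bounded_bilinear C by fact
  obtain K L where K: "\<And>x y. norm (B x y) \<le> norm x * norm y * K"
    and L: "\<And>x y. norm (C x y) \<le> norm x * norm y * L"
    using B.bounded C.bounded by auto
  show ?thesis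
  proof
    have "norm (B x y + C x y) \<le> norm x * norm y * (K + L)" for x y
      using norm_triangle_mono[OF K L] by (simp add: distrib_left)
    then show "\<exists>K. \<forall>x y. norm (B x y + C x y) \<le> norm x * norm y * K" by blast
  qed (simp_all add: B.add_left B.add_right B.scaleR_left B.scaleR_right
      C.add_left C.add_right C.scaleR_left C.scaleR_right scaleR_add_right)
qed

section \<open>The saddle-point problem\<close>

locale saddle_point =
  fixes a :: "'u::{real_inner, complete_space} \<Rightarrow> 'u \<Rightarrow> real"
    and b :: "'z::{real_inner, complete_space} \<Rightarrow> 'u \<Rightarrow> real"
    and d :: "'u \<Rightarrow> 'u \<Rightarrow> real"
    and e :: "'z \<Rightarrow> 'z \<Rightarrow> real"
    and \<alpha> \<gamma> :: real
  assumes a: "bounded_bilinear a" and b: "bounded_bilinear b"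
    and d: "bounded_bilinear d" and e: "bounded_bilinear e"
    and coer_a: "coercive a \<alpha>" and coer_e: "coercive e \<gamma>" and semidef_d: "pos_semidef d"
begin

sublocale a: bounded_bilinear a by (rule a)
sublocale b: bounded_bilinear b by (rule b)
sublocale d: bounded_bilinear d by (rule d)
sublocale e: bounded_bilinear e by (rule e)

abbreviation "solution \<equiv> saddle_point_solution a b d e"
abbreviation "cont \<equiv> cont_const a b d e"

text \<open>As functionals of the test function, \<open>lhs1\<close> and \<open>lhs2\<close> can
  serve as data of another saddle-point problem; this is how residuals enter the stability
  bound.\<close>

definition lhs1 :: "'u \<times> 'z \<times> 'u \<Rightarrow> 'u \<times> 'z \<Rightarrow> real" where
  "lhs1 = (\<lambda>(u, z, p) (v, y). d u v + e z y + a v p + b y p)"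

definition lhs2 :: "'u \<times> 'z \<times> 'u \<Rightarrow> 'u \<Rightarrow> real" where
  "lhs2 = (\<lambda>(u, z, p) q. a u q + b z q)"

lemma solution_iff:
  "solution U Z f g (u, z, p) \<longleftrightarrow> u \<in> U \<and> z \<in> Z \<and> p \<in> U \<and>
    (\<forall>t\<in>U \<times> Z. lhs1 (u, z, p) t = g t) \<and> (\<forall>q\<in>U. lhs2 (u, z, p) q = f q)"
  by (auto simp: saddle_point_solution_def lhs1_def lhs2_def)

lemma lhs_diff:
  "lhs1 (u - u', z - z', p - p') t = lhs1 (u, z, p) t - lhs1 (u', z', p') t"
  "lhs2 (u - u', z - z', p - p') q = lhs2 (u, z, p) q - lhs2 (u', z', p') q"
  by (simp_all add: lhs1_def lhs2_def split_beta a.diff_left a.diff_right b.diff_left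
      b.diff_right d.diff_left e.diff_left)

lemma \<alpha>_pos: "0 < \<alpha>" and \<gamma>_pos: "0 < \<gamma>"
  using coer_a coer_e by (auto simp: coercive_def)

text \<open>In the equation for \<open>p\<close> the unknown is the second argument of
  \<open>a\<close>, so Lax-Milgram is applied to the flipped form.\<close>

lemma coer_flip: "coercive (\<lambda>x y. a y x) \<alpha>"
  using coer_a by (simp add: coercive_def)

section \<open>Stability estimate with an explicit constant\<close>

text \<open>Coercivity of \<open>a\<close> bounds \<open>u\<close> through \<open>z\<close> and
  \<open>p\<close> through \<open>u\<close>, while a test function that cancels \<open>p\<close>
  bounds \<open>z\<close> by the data alone. Back substitution yields
  \<open>stab_const\<close>.\<close>

lemma stability:
  assumes U: "subspace U" "closed U" and Z: "subspace Z" "closed Z"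
    and f: "bounded_linear f" and g: "bounded_linear g"
    and sol: "solution U Z f g (u, z, p)"
  shows "norm u + norm z + norm p \<le>
    stab_const (bilinear_norm b) (bilinear_norm d) \<alpha> \<gamma> *
      (dual_norm_on U f + dual_norm_on (U \<times> Z) g)"
proof -
  define nb nd F G where "nb = bilinear_norm b" and "nd = bilinear_norm d"
    and "F = dual_norm_on U f" and "G = dual_norm_on (U \<times> Z) g"
  \<comment> \<open>In the final sum, \<open>\<rho>\<close> is the coefficient of
    \<open>norm u\<close> after elimination of \<open>p\<close>, and \<open>M\<close> that of
    \<open>norm z\<close> after elimination of \<open>u\<close>.\<close>
  define \<rho> M where "\<rho> = 1 + nd / \<alpha>" and "M = 1 + nb / \<alpha> * \<rho>"
  have in_UZ: "u \<in> U" "z \<in> Z" "p \<in> U"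
    and eq1: "\<And>v y. v \<in> U \<Longrightarrow> y \<in> Z \<Longrightarrow> d u v + e z y + a v p + b y p = g (v, y)"
    and eq2: "\<And>q. q \<in> U \<Longrightarrow> a u q + b z q = f q"
    using sol by (auto simp: saddle_point_solution_def)
  have pos: "0 \<le> nb" "0 \<le> nd" "0 \<le> F" "0 \<le> G"
    using bilinear_norm_nonneg[OF b] bilinear_norm_nonneg[OF d] dual_norm_on_nonneg[OF f U(1)]
      dual_norm_on_nonneg[OF g subspace_Times[OF U(1) Z(1)]]
    by (auto simp: nb_def nd_def F_def G_def)
  have \<rho>: "1 \<le> \<rho>" and M: "1 \<le> M"
    using pos \<alpha>_pos by (auto simp: \<rho>_def M_def)
  note b_le = bilinear_norm_bound[OF b, folded nb_def]
  note d_le = bilinear_norm_bound[OF d, folded nd_def]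
  have f_le: "\<bar>f q\<bar> \<le> F * norm q" if "q \<in> U" for q
    using dual_norm_on_bound[OF f that] by (simp add: F_def)
  have g_le: "\<bar>g (v, y)\<bar> \<le> G * (norm v + norm y)" if "v \<in> U" "y \<in> Z" for v y
  proof -
    have "\<bar>g (v, y)\<bar> \<le> G * norm (v, y)"
      using dual_norm_on_bound[OF g, of "(v, y)" "U \<times> Z"] that by (simp add: G_def)
    also have "\<dots> \<le> G * (norm v + norm y)"
      using pos by (intro mult_left_mono norm_Pair_le_add)
    finally show ?thesis .
  qed
  have u_le: "norm u \<le> (F + nb * norm z) / \<alpha>"
  proof (rule coercive_bound[OF coer_a])
    show "a u u \<le> (F + nb * norm z) * norm u"
      using eq2[OF in_UZ(1)] f_le[OF in_UZ(1)] b_le[of z u] by (simp add: distrib_right)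
  qed (use pos in auto)
  have p_le: "norm p \<le> (G + nd * norm u) / \<alpha>"
  proof (rule coercive_bound[OF coer_a])
    \<comment> \<open>The test pair \<open>(p, 0)\<close> leaves only \<open>a p p\<close>,
      \<open>d u p\<close> and the data.\<close>
    show "a p p \<le> (G + nd * norm u) * norm p"
      using eq1[OF in_UZ(3) subspace_0[OF Z(1)]] g_le[OF in_UZ(3) subspace_0[OF Z(1)]] d_le[of u p]
      by (simp add: distrib_right e.zero_right b.zero_left)
  qed (use pos in auto)
  \<comment> \<open>The test function \<open>(w, z)\<close> removes \<open>p\<close> and leaves only terms with a factor \<open>norm z\<close>.\<close>
  obtain w where w: "w \<in> U" "\<And>q. q \<in> U \<Longrightarrow> a w q = - b z q"
    using lax_milgram_on[OF U a coer_a bounded_linear_minus[OF b.bounded_linear_right]] by blast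
  have w_le: "norm w \<le> nb / \<alpha> * norm z"
  proof -
    have "norm w \<le> (nb * norm z) / \<alpha>"
      by (rule coercive_bound[OF coer_a]) (use pos w b_le[of z w] in auto)
    then show ?thesis by simp
  qed
  \<comment> \<open>In \<open>a (u - w) q\<close> the terms with \<open>z\<close> cancel and
    \<open>f q\<close> is left, so this difference, unlike \<open>u\<close>, is bounded without
    \<open>z\<close>.\<close>
  have uw_le: "norm (u - w) \<le> F / \<alpha>"
  proof (rule coercive_bound[OF coer_a])
    have "u - w \<in> U" using in_UZ w U by (intro subspace_diff)
    then show "a (u - w) (u - w) \<le> F * norm (u - w)"
      using eq2[of "u - w"] w(2)[of "u - w"] f_le[of "u - w"] by (simp add: a.diff_left)
  qed (use pos in auto)
  have z_le: "norm z \<le> M * (F + G) / \<gamma>"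
  proof (rule coercive_bound[OF coer_e])
    \<comment> \<open>The terms with \<open>p\<close> cancel by the choice of \<open>w\<close>.
      Splitting \<open>u\<close> as \<open>(u - w) + w\<close> isolates \<open>d w w\<close>, the
      only part quadratic in \<open>w\<close>, which has a favourable sign.\<close>
    have "e z z = g (w, z) - d (u - w) w - d w w"
      using eq1[OF w(1) in_UZ(2)] w(2)[OF in_UZ(3)] by (simp add: d.diff_left)
    also have "\<dots> \<le> G * (norm w + norm z) + nd * norm (u - w) * norm w"
      using g_le[OF w(1) in_UZ(2)] d_le[of "u - w" w] semidef_d[unfolded pos_semidef_def, rule_format, of w]
      by linarith
    also have "\<dots> \<le> G * (nb / \<alpha> * norm z + norm z) + nd * (F / \<alpha>) * (nb / \<alpha> * norm z)"
      using pos w_le uw_le \<alpha>_pos by (intro add_mono mult_left_mono mult_mono) auto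
    also have "\<dots> = (G * (1 + nb / \<alpha>) + F * (nb / \<alpha> * (nd / \<alpha>))) * norm z"
      by (simp add: algebra_simps)
    \<comment> \<open>\<open>M\<close> equals
      \<open>1 + nb / \<alpha> + nb / \<alpha> * (nd / \<alpha>)\<close>, so it dominates both
      coefficients.\<close>
    also have "\<dots> \<le> (G * M + F * M) * norm z"
      using pos \<alpha>_pos by (intro mult_right_mono add_mono mult_left_mono)
        (auto simp: M_def \<rho>_def distrib_left)
    finally show "e z z \<le> M * (F + G) * norm z"
      by (simp add: algebra_simps)
  qed (use pos M in auto)
  have "norm u + norm z + norm p \<le> G / \<alpha> + \<rho> * norm u + norm z"
    using p_le by (simp add: \<rho>_def add_divide_distrib distrib_right)
  also have "\<dots> \<le> G / \<alpha> + \<rho> * ((F + nb * norm z) / \<alpha>) + norm z"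
    using u_le \<rho> by (intro add_mono mult_left_mono) auto
  also have "\<dots> = (G + \<rho> * F) / \<alpha> + M * norm z"
    by (simp add: M_def add_divide_distrib algebra_simps)
  \<comment> \<open>\<open>G\<close> is enlarged to \<open>\<rho> * G\<close> so that
    \<open>F + G\<close> factors out.\<close>
  also have "\<dots> \<le> (\<rho> * G + \<rho> * F) / \<alpha> + M * (M * (F + G) / \<gamma>)"
    using z_le M \<rho> pos \<alpha>_pos mult_right_mono[OF \<rho> pos(4)]
    by (intro add_mono divide_right_mono mult_left_mono) auto
  also have "\<dots> = stab_const nb nd \<alpha> \<gamma> * (F + G)"
    unfolding stab_const_def Let_def \<rho>_def[symmetric] M_def[symmetric]
    by (simp add: power2_eq_square add_divide_distrib algebra_simps)
  finally show ?thesis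
    by (simp add: nb_def nd_def F_def G_def)
qed

lemma uniform_stability:
  "uniform_stability_const a b d e (stab_const (bilinear_norm b) (bilinear_norm d) \<alpha> \<gamma>)"
  unfolding uniform_stability_const_def
proof (intro conjI allI impI)
  have "0 < 1 + bilinear_norm d / \<alpha>"
    using bilinear_norm_nonneg[OF d] \<alpha>_pos by (intro add_pos_nonneg) auto
  then show "0 < stab_const (bilinear_norm b) (bilinear_norm d) \<alpha> \<gamma>"
    using \<alpha>_pos \<gamma>_pos unfolding stab_const_def Let_def
    by (intro add_pos_nonneg[of "_ / _"] divide_pos_pos divide_nonneg_pos) auto
qed (use stability in blast)

section \<open>Existence and uniqueness\<close>

text \<open>The unknowns are found in the order \<open>z\<close>, \<open>u\<close>,
  \<open>p\<close>: the reduced problem on \<open>Z\<close>, back substitution, then a problem for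
  \<open>p\<close> with test pairs \<open>(v, 0)\<close>.\<close>

lemma solution_exists:
  assumes U: "subspace U" "closed U" and Z: "subspace Z" "closed Z"
    and f: "bounded_linear f" and g: "bounded_linear g"
  shows "\<exists>u z p. solution U Z f g (u, z, p)"
proof -
  interpret f: bounded_linear f by fact
  interpret g: bounded_linear g by fact
  obtain T where T: "bounded_linear T" "\<And>z. T z \<in> U" "\<And>z q. q \<in> U \<Longrightarrow> a (T z) q = b z q"
    using lax_milgram_operator_on[OF U a coer_a b] by blast
  interpret T: bounded_linear T by (rule T)
  obtain uf where uf: "uf \<in> U" "\<And>q. q \<in> U \<Longrightarrow> a uf q = f q"
    using lax_milgram_on[OF U a coer_a f] by blast
  define E where "E z y = e z y + d (T z) (T y)" for z y
  have E: "bounded_bilinear E"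
    unfolding E_def by (intro bounded_bilinear_add e d.comp T(1))
  \<comment> \<open>The added term \<open>d (T z) (T z)\<close> is nonnegative, so \<open>E\<close>
    inherits the constant of \<open>e\<close>.\<close>
  have "coercive E \<gamma>"
    using coer_e semidef_d unfolding coercive_def pos_semidef_def E_def
    by (smt (verit))
  \<comment> \<open>This right-hand side comes from the test pair \<open>(- T y, y)\<close> with
    \<open>u = uf - T z\<close>; the part \<open>d (T z) (T y)\<close> has moved into
    \<open>E\<close>.\<close>
  moreover have "bounded_linear (\<lambda>y. g (- T y, y) + d uf (T y))"
    by (intro bounded_linear_add bounded_linear_compose[OF g] bounded_linear_Pair
        bounded_linear_minus T bounded_linear_ident bounded_linear_compose[OF d.bounded_linear_right])
  ultimately obtain z where z: "z \<in> Z" "\<And>y. y \<in> Z \<Longrightarrow> E z y = g (- T y, y) + d uf (T y)"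
    using lax_milgram_on[OF Z E] by blast
  define u where "u = uf - T z"
  have u: "u \<in> U" using uf T U by (auto simp: u_def intro: subspace_diff)
  have "bounded_linear (\<lambda>v. g (v, 0) - d u v)"
    by (intro bounded_linear_sub bounded_linear_compose[OF g] bounded_linear_Pair
        bounded_linear_ident bounded_linear_zero d.bounded_linear_right)
  then obtain p where p: "p \<in> U" "\<And>v. v \<in> U \<Longrightarrow> a v p = g (v, 0) - d u v"
    using lax_milgram_on[OF U a.flip coer_flip] by blast
  have "d u v + e z y + a v p + b y p = g (v, y)" if "v \<in> U" "y \<in> Z" for v y
  proof -
    \<comment> \<open>\<open>b y p\<close> equals \<open>a (T y) p\<close>, which the equation for
      \<open>p\<close> evaluates.\<close>
    have "b y p = g (T y, 0) - d u (T y)"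
      using T(2) T(3)[OF p(1)] p(2) by metis
    moreover have "e z y = g (- T y, y) + d u (T y)"
      using z(2)[OF that(2)] by (simp add: E_def u_def d.diff_left)
    \<comment> \<open>The test pair splits as \<open>(v, 0) + (- T y, y) + (T y, 0)\<close>, one
      summand for each of the identities for \<open>p\<close>, \<open>z\<close> and
      \<open>b y p\<close>.\<close>
    moreover have "g (v, y) = g (v, 0) + g (- T y, y) + g (T y, 0)"
      by (simp add: g.add[symmetric])
    ultimately show ?thesis using p(2)[OF that(1)] by simp
  qed
  moreover have "a u q + b z q = f q" if "q \<in> U" for q
    using uf(2) T(3) that by (simp add: u_def a.diff_left)
  ultimately have "solution U Z f g (u, z, p)"
    using u z p by (simp add: saddle_point_solution_def)
  then show ?thesis by blast
qed

lemma solution_diff: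
  assumes "subspace U" "subspace Z"
    and "solution U Z f g (u, z, p)" "solution U Z f' g' (u', z', p')"
  shows "solution U Z (\<lambda>q. f q - f' q) (\<lambda>v. g v - g' v) (u - u', z - z', p - p')"
  using assms by (auto simp: solution_iff subspace_diff lhs_diff)

text \<open>The difference of two solutions solves the homogeneous problem, and the stability bound
  with zero data makes it vanish.\<close>

lemma solution_unique:
  assumes U: "subspace U" "closed U" and Z: "subspace Z" "closed Z"
    and sols: "solution U Z f g (u, z, p)" "solution U Z f g (u', z', p')"
  shows "(u, z, p) = (u', z', p')"
proof -
  have "solution U Z (\<lambda>_. 0) (\<lambda>_. 0) (u - u', z - z', p - p')"
    using solution_diff[OF U(1) Z(1) sols] by simp
  then have "norm (u - u') + norm (z - z') + norm (p - p') \<le>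
    stab_const (bilinear_norm b) (bilinear_norm d) \<alpha> \<gamma> *
      (dual_norm_on U (\<lambda>_. 0) + dual_norm_on (U \<times> Z) (\<lambda>_. 0))"
    using stability[OF U Z bounded_linear_zero bounded_linear_zero] by blast
  \<comment> \<open>Nonemptiness makes the supremum of the constant 0 equal to 0.\<close>
  moreover have "U \<noteq> {}" "U \<times> Z \<noteq> {}"
    using subspace_0[OF U(1)] subspace_0[OF Z(1)] by auto
  then have "dual_norm_on U (\<lambda>_. 0) = 0" "dual_norm_on (U \<times> Z) (\<lambda>_. 0) = 0"
    by (simp_all add: dual_norm_on_def)
  ultimately have "norm (u - u') + norm (z - z') + norm (p - p') \<le> 0" by simp
  then have "norm (u - u') = 0" "norm (z - z') = 0" "norm (p - p') = 0"
    by (smt (verit) norm_ge_zero)+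
  then show ?thesis by simp
qed

lemma solution_ex1:
  assumes "subspace U" "closed U" "subspace Z" "closed Z" "bounded_linear f" "bounded_linear g"
  shows "\<exists>!w. solution U Z f g w"
proof -
  obtain w where "solution U Z f g w"
    using solution_exists[OF assms] by blast
  moreover have "w' = w''" if "solution U Z f g w'" "solution U Z f g w''" for w' w''
    using solution_unique[OF assms(1-4)] that by (cases w', cases w'') blast
  ultimately show ?thesis by blast
qed

section \<open>Continuity bounds and quasi-optimality\<close>

lemma cont_nonneg: "0 \<le> cont"
  using bilinear_norm_nonneg[OF a] by (auto simp: cont_const_def le_max_iff_disj)

lemma cont_bounds:
  "\<bar>a x v\<bar> \<le> cont * norm x * norm v" "\<bar>b y v\<bar> \<le> cont * norm y * norm v"
  "\<bar>d x v\<bar> \<le> cont * norm x * norm v" "\<bar>e y t\<bar> \<le> cont * norm y * norm t"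
proof -
  have le: "bilinear_norm a \<le> cont" "bilinear_norm b \<le> cont"
    "bilinear_norm d \<le> cont" "bilinear_norm e \<le> cont"
    by (auto simp: cont_const_def)
  show "\<bar>a x v\<bar> \<le> cont * norm x * norm v"
    by (rule order_trans[OF bilinear_norm_bound[OF a]]) (intro mult_right_mono le norm_ge_zero)
  show "\<bar>b y v\<bar> \<le> cont * norm y * norm v"
    by (rule order_trans[OF bilinear_norm_bound[OF b]]) (intro mult_right_mono le norm_ge_zero)
  show "\<bar>d x v\<bar> \<le> cont * norm x * norm v"
    by (rule order_trans[OF bilinear_norm_bound[OF d]]) (intro mult_right_mono le norm_ge_zero)
  show "\<bar>e y t\<bar> \<le> cont * norm y * norm t"
    by (rule order_trans[OF bilinear_norm_bound[OF e]]) (intro mult_right_mono le norm_ge_zero)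
qed

text \<open>Through this choice of data an arbitrary triple enters the stability bound, which gives
  the lower bound on \<open>2 * C * cont\<close>.\<close>

lemma solution_lhs:
  assumes "u \<in> U" "z \<in> Z" "p \<in> U"
  shows "solution U Z (lhs2 (u, z, p)) (lhs1 (u, z, p)) (u, z, p)"
  using assms by (simp add: solution_iff)

lemma bounded_linear_lhs: "bounded_linear (lhs1 w)" "bounded_linear (lhs2 w)"
proof -
  obtain u z p where w: "w = (u, z, p)" by (cases w)
  have "lhs1 w = (\<lambda>t. d u (fst t) + e z (snd t) + a (fst t) p + b (snd t) p)"
    by (auto simp: lhs1_def w)
  then show "bounded_linear (lhs1 w)"
    by (auto intro!: bounded_linear_add d.bounded_linear_right[THEN bounded_linear_compose]
        e.bounded_linear_right[THEN bounded_linear_compose]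
        a.bounded_linear_left[THEN bounded_linear_compose]
        b.bounded_linear_left[THEN bounded_linear_compose] bounded_linear_fst bounded_linear_snd)
  show "bounded_linear (lhs2 w)"
    by (auto simp: lhs2_def w
        intro!: bounded_linear_add a.bounded_linear_right b.bounded_linear_right)
qed

text \<open>Each component of the triple occurs in two of the six terms: \<open>u\<close> with
  \<open>a\<close> and \<open>d\<close>, \<open>z\<close> with \<open>b\<close> and
  \<open>e\<close>, \<open>p\<close> with \<open>a\<close> and \<open>b\<close>. Hence the factor
  2.\<close>

lemma dual_norm_lhs_le:
  assumes U: "subspace U" and Z: "subspace Z"
  shows "dual_norm_on U (lhs2 (u, z, p)) + dual_norm_on (U \<times> Z) (lhs1 (u, z, p))
    \<le> 2 * cont * (norm u + norm z + norm p)"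
proof -
  have "dual_norm_on U (lhs2 (u, z, p)) \<le> cont * (norm u + norm z)"
  proof (rule dual_norm_on_least[OF U])
    show "\<bar>lhs2 (u, z, p) q\<bar> \<le> cont * (norm u + norm z) * norm q" for q
      using cont_bounds(1)[of u q] cont_bounds(2)[of z q]
      by (simp add: lhs2_def algebra_simps)
  qed (use cont_nonneg in auto)
  moreover have "dual_norm_on (U \<times> Z) (lhs1 (u, z, p))
    \<le> cont * ((norm u + norm p) + (norm z + norm p))"
  proof (rule dual_norm_on_least[OF subspace_Times[OF U Z]])
    show "\<bar>lhs1 (u, z, p) t\<bar> \<le> cont * ((norm u + norm p) + (norm z + norm p)) * norm t" for t
    proof -
      obtain v y where t: "t = (v, y)" by (cases t)
      have "\<bar>lhs1 (u, z, p) t\<bar> \<le>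
        cont * (norm v * (norm u + norm p) + norm y * (norm z + norm p))"
        using cont_bounds(1)[of v p] cont_bounds(2)[of y p] cont_bounds(3)[of u v]
          cont_bounds(4)[of z y]
        by (simp add: lhs1_def t algebra_simps)
      also have "\<dots> \<le> cont * (((norm u + norm p) + (norm z + norm p)) * norm t)"
        unfolding t by (intro mult_left_mono norm_Pair_weighted_le cont_nonneg) auto
      finally show ?thesis by (simp add: mult.assoc)
    qed
  qed (use cont_nonneg in auto)
  ultimately show ?thesis by (simp add: algebra_simps)
qed

text \<open>Bounds the Galerkin projection, which sends a triple to the discrete solution with the
  data generated by that triple.\<close>

lemma uniform_stability_lhs:
  assumes C: "uniform_stability_const a b d e C"
    and U: "subspace U" "closed U" and Z: "subspace Z" "closed Z"
    and sol: "solution U Z (lhs2 (u, z, p)) (lhs1 (u, z, p)) (u', z', p')"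
  shows "norm u' + norm z' + norm p' \<le> 2 * C * cont * (norm u + norm z + norm p)"
proof -
  have "0 < C" and le: "norm u' + norm z' + norm p' \<le>
    C * (dual_norm_on U (lhs2 (u, z, p)) + dual_norm_on (U \<times> Z) (lhs1 (u, z, p)))"
    using C U Z sol bounded_linear_lhs unfolding uniform_stability_const_def by blast+
  note le
  also have "C * (dual_norm_on U (lhs2 (u, z, p)) + dual_norm_on (U \<times> Z) (lhs1 (u, z, p)))
    \<le> C * (2 * cont * (norm u + norm z + norm p))"
    using \<open>0 < C\<close> by (intro mult_left_mono dual_norm_lhs_le U Z) simp
  finally show ?thesis by (simp only: mult.assoc mult.left_commute)
qed

text \<open>The triple \<open>(u, z, 0)\<close> is the exact solution of the problem with the data it generates.\<close>

lemma one_le_stab_cont: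
  fixes u :: 'u and z :: 'z
  assumes C: "uniform_stability_const a b d e C" and "u \<noteq> 0 \<or> z \<noteq> 0"
  shows "1 \<le> 2 * C * cont"
proof -
  have "norm u + norm z + norm (0::'u) \<le> 2 * C * cont * (norm u + norm z + norm (0::'u))"
    using solution_lhs[of u UNIV z UNIV 0]
    by (intro uniform_stability_lhs[OF C, of UNIV UNIV]) auto
  moreover have "0 < norm u + norm z"
    using assms(2) by (auto intro: add_pos_nonneg add_nonneg_pos)
  ultimately show ?thesis by simp
qed

text \<open>The error is at most the error of \<open>(v, y, q)\<close> plus the distance of that
  triple from the Galerkin solution, and the latter is the Galerkin projection of the
  former.\<close>

lemma quasi_optimal:
  assumes C: "uniform_stability_const a b d e C"
    and U: "subspace U" "closed U" and Z: "subspace Z" "closed Z"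
    and sol: "solution UNIV UNIV f g (u, z, p)" and sol': "solution U Z f g (u', z', p')"
    and vyq: "v \<in> U" "y \<in> Z" "q \<in> U"
  shows "norm (u - u') + norm (z - z') + norm (p - p')
    \<le> opt_const C cont * (norm (u - v) + norm (z - y) + norm (p - q))"
    (is "?err \<le> _ * ?E")
proof (cases "\<exists>(u::'u) (z::'z). u \<noteq> 0 \<or> z \<noteq> 0")
  case False
  then have *: "x = 0" "t = 0" for x :: 'u and t :: 'z by auto
  show ?thesis
    by (simp add: *(1)[of "_ - _"] *(2)[of "_ - _"])
next
  case True
  then have one: "1 \<le> 2 * C * cont" using one_le_stab_cont[OF C] by blast
  \<comment> \<open>Galerkin orthogonality: tested on the subspaces, the exact and the discrete
    solution have equal left-hand sides.\<close>
  have "solution U Z (lhs2 (u - v, z - y, p - q)) (lhs1 (u - v, z - y, p - q))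
    (u' - v, z' - y, p' - q)"
    using sol sol' vyq U Z by (auto simp: solution_iff subspace_diff lhs_diff)
  from uniform_stability_lhs[OF C U Z this]
  have diff: "norm (u' - v) + norm (z' - y) + norm (p' - q) \<le> 2 * C * cont * ?E" .
  have "?err \<le> ?E + (norm (u' - v) + norm (z' - y) + norm (p' - q))"
    using norm_triangle_ineq4[of "u - v" "u' - v"] norm_triangle_ineq4[of "z - y" "z' - y"]
      norm_triangle_ineq4[of "p - q" "p' - q"] by simp
  \<comment> \<open>The summand \<open>?E\<close> from the triangle inequality is absorbed into the
    constant, which gives the factor 4.\<close>
  also have "\<dots> \<le> (2 * C * cont) * ?E + 2 * C * cont * ?E"
    using diff mult_right_mono[OF one, of ?E] by simp
  also have "\<dots> = opt_const C cont * ?E"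
    by (simp add: opt_const_def algebra_simps)
  finally show ?thesis .
qed

end

text \<open>Quasi-optimality is claimed for every uniform stability constant; the explicit
  \<open>stab_const\<close> shows that there is one. Positivity of \<open>opt_const\<close> excludes
  trivial spaces, where all quotients in \<open>bilinear_norm\<close>, and hence
  \<open>cont_const\<close>, are 0.\<close>

theorem mainTheorem3:
  fixes a :: "'u::{real_inner, complete_space} \<Rightarrow> 'u \<Rightarrow> real"
    and b :: "'z::{real_inner, complete_space} \<Rightarrow> 'u \<Rightarrow> real"
    and d :: "'u \<Rightarrow> 'u \<Rightarrow> real"
    and e :: "'z \<Rightarrow> 'z \<Rightarrow> real"
    and f :: "'u \<Rightarrow> real"
    and g :: "'u \<times> 'z \<Rightarrow> real"
    and \<alpha> \<gamma> :: real
  assumes "bounded_bilinear a" and "bounded_bilinear b"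
    and "bounded_bilinear d" and "bounded_bilinear e"
    and "coercive a \<alpha>" and "coercive e \<gamma>" and "pos_semidef d"
    and "bounded_linear f" and "bounded_linear g"
  shows "(\<exists>!w. saddle_point_solution a b d e UNIV UNIV f g w) \<and>
    uniform_stability_const a b d e
      (stab_const (bilinear_norm b) (bilinear_norm d) \<alpha> \<gamma>) \<and>
    (\<forall>Cstab u z p.
      uniform_stability_const a b d e Cstab \<and>
      saddle_point_solution a b d e UNIV UNIV f g (u, z, p) \<longrightarrow>
      ((UNIV :: ('u \<times> 'z) set) \<noteq> {0} \<longrightarrow> 0 < opt_const Cstab (cont_const a b d e)) \<and>
      (\<forall>U\<^sub>\<delta> Z\<^sub>\<delta>. subspace U\<^sub>\<delta> \<and> closed U\<^sub>\<delta> \<and> subspace Z\<^sub>\<delta> \<and> closed Z\<^sub>\<delta> \<longrightarrow>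
        (\<exists>!w. saddle_point_solution a b d e U\<^sub>\<delta> Z\<^sub>\<delta> f g w) \<and>
        (\<forall>u\<^sub>\<delta> z\<^sub>\<delta> p\<^sub>\<delta>. saddle_point_solution a b d e U\<^sub>\<delta> Z\<^sub>\<delta> f g (u\<^sub>\<delta>, z\<^sub>\<delta>, p\<^sub>\<delta>) \<longrightarrow>
          norm (u - u\<^sub>\<delta>) + norm (z - z\<^sub>\<delta>) + norm (p - p\<^sub>\<delta>)
            \<le> opt_const Cstab (cont_const a b d e) *
              (INF (v, y, q) \<in> U\<^sub>\<delta> \<times> Z\<^sub>\<delta> \<times> U\<^sub>\<delta>.
                norm (u - v) + norm (z - y) + norm (p - q)))))"
proof -
  interpret saddle_point a b d e \<alpha> \<gamma>
    by (rule saddle_point.intro) fact+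
  show ?thesis
  proof (intro conjI allI impI; (elim conjE)?)
    show "\<exists>!w. solution UNIV UNIV f g w"
      using assms by (intro solution_ex1) auto
    show "uniform_stability_const a b d e
        (stab_const (bilinear_norm b) (bilinear_norm d) \<alpha> \<gamma>)"
      by (rule uniform_stability)
  next
    fix C
    assume C: "uniform_stability_const a b d e C" and "(UNIV :: ('u \<times> 'z) set) \<noteq> {0}"
    then obtain x :: 'u and t :: 'z where "x \<noteq> 0 \<or> t \<noteq> 0"
      by (auto simp: zero_prod_def)
    from one_le_stab_cont[OF C this] show "0 < opt_const C cont"
      by (simp add: opt_const_def)
  next
    fix U :: "'u set" and Z :: "'z set"
    assume "subspace U" "closed U" "subspace Z" "closed Z"
    then show "\<exists>!w. solution U Z f g w"
      using assms by (intro solution_ex1) auto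
  next
    fix C u z p U Z u' z' p'
    assume C: "uniform_stability_const a b d e C"
      and sol: "solution UNIV UNIV f g (u, z, p)"
      and U: "subspace U" "closed U" and Z: "subspace Z" "closed Z"
      and sol': "solution U Z f g (u', z', p')"
    let ?err = "norm (u - u') + norm (z - z') + norm (p - p')"
    let ?E = "\<lambda>(v, y, q). norm (u - v) + norm (z - y) + norm (p - q)"
    have le: "?err \<le> opt_const C cont * ?E w" if "w \<in> U \<times> Z \<times> U" for w
      using quasi_optimal[OF C U Z sol sol'] that by auto
    have ne: "U \<times> Z \<times> U \<noteq> {}"
      using subspace_0[OF U(1)] subspace_0[OF Z(1)] by auto
    have "0 \<le> opt_const C cont"
      using C cont_nonneg by (simp add: opt_const_def uniform_stability_const_def)
    \<comment> \<open>A positive constant can be divided out, which turns the bounds for single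
      triples into a lower bound for the infimum. If it is 0, any one triple of the nonempty set
      gives \<open>?err \<le> 0\<close>.\<close>
    then consider "opt_const C cont = 0" | "0 < opt_const C cont" by linarith
    then show "?err \<le> opt_const C cont * (INF w \<in> U \<times> Z \<times> U. ?E w)"
    proof cases
      case 1
      then show ?thesis using le ne by auto
    next
      case 2
      then have "?err / opt_const C cont \<le> (INF w \<in> U \<times> Z \<times> U. ?E w)"
        using le by (intro cINF_greatest[OF ne]) (simp add: divide_le_eq mult.commute)
      then show ?thesis using 2 by (simp add: divide_le_eq mult.commute)
    qed
  qed
qed

end
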